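(* Let $\lambda>0$ and let $\Lambda$, $W$, $Y$ be arbitrary random variables with $W>0$ and $Y>0$ a.s. Let $(\Lambda_i)_{i\ge1}$, $(W_i)_{i\ge1}$, $(Y_i)_{i\ge1}$ be mutually independent i.i.d. sequences of copies of $\Lambda$, $W$, $Y$, respectively. For $k\ge1$ define $$\widehat D_k=1+\sum_{i=1}^{k}\mathbf 1_{\{\Lambda_i+\log W_i+\lambda Y_i<M_k\}},\qquad M_k=\max_{1\le i\le k}\left(\Lambda_i+\log W_i-\lambda Y_i\right).$$ If $\mathbb P(\Lambda>x)>0$ for each $x\in\mathbb R$, or if $\mathbb P(W>x)>0$ for each $x\in\mathbb R$, then $\widehat D_k=k(1-o_{\mathbb P}(1))$ as $k\to\infty$.
   Context: $o_{\mathbb P}(1)$ denotes a quantity converging to $0$ in probability as $k\to\infty$; thus the conclusion says $\widehat D_k/k\to1$ in probability. *)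

theory Defs
  imports "HOL-Probability.Probability"
begin

text \<open>All sequences start at index 1, so their value at index 0 is irrelevant.\<close>

text \<open>The variable \<open>Z\<close> may live on a probability space \<open>N\<close> different from \<open>P\<close>.\<close>

definition iid_copies ::
  "'a measure \<Rightarrow> (nat \<Rightarrow> 'a \<Rightarrow> real) \<Rightarrow> 'b measure \<Rightarrow> ('b \<Rightarrow> real) \<Rightarrow> bool" where
  "iid_copies P X N Z \<longleftrightarrow>
     prob_space.indep_vars P (\<lambda>_. borel) X {1..} \<and>
     (\<forall>i\<ge>1. distr P borel (X i) = distr N borel Z)"

text \<open>Each sequence is regarded as one random element of the product space indexed by \<open>{1..}\<close>.\<close>

definition mutually_indep_seqs :: "'a measure \<Rightarrow> (nat \<Rightarrow> 'a \<Rightarrow> real) list \<Rightarrow> bool" where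
  "mutually_indep_seqs P Xs \<longleftrightarrow>
     prob_space.indep_vars P (\<lambda>_. PiM {1..} (\<lambda>_. borel))
       (\<lambda>s \<omega>. \<lambda>i\<in>{1..}. (Xs ! s) i \<omega>) {..<length Xs}"

text \<open>Measurability is part of the definition because \<open>measure\<close> is 0 on non-measurable sets.\<close>

definition tendsto_in_prob :: "'a measure \<Rightarrow> (nat \<Rightarrow> 'a \<Rightarrow> real) \<Rightarrow> real \<Rightarrow> bool" where
  "tendsto_in_prob P X c \<longleftrightarrow>
     (\<forall>k. X k \<in> borel_measurable P) \<and>
     (\<forall>\<epsilon>>0. (\<lambda>k. measure P {\<omega> \<in> space P. \<bar>X k \<omega> - c\<bar> > \<epsilon>}) \<longlonglongrightarrow> 0)"

definition M_max ::
  "real \<Rightarrow> (nat \<Rightarrow> 'a \<Rightarrow> real) \<Rightarrow> (nat \<Rightarrow> 'a \<Rightarrow> real) \<Rightarrow> (nat \<Rightarrow> 'a \<Rightarrow> real) \<Rightarrow> nat \<Rightarrow> 'a \<Rightarrow> real" where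
  "M_max lam L W Y k \<omega> = Max ((\<lambda>i. L i \<omega> + ln (W i \<omega>) - lam * Y i \<omega>) ` {1..k})"

definition D_hat ::
  "real \<Rightarrow> (nat \<Rightarrow> 'a \<Rightarrow> real) \<Rightarrow> (nat \<Rightarrow> 'a \<Rightarrow> real) \<Rightarrow> (nat \<Rightarrow> 'a \<Rightarrow> real) \<Rightarrow> nat \<Rightarrow> 'a \<Rightarrow> real" where
  "D_hat lam L W Y k \<omega> =
     1 + (\<Sum>i=1..k. if L i \<omega> + ln (W i \<omega>) + lam * Y i \<omega> < M_max lam L W Y k \<omega> then 1 else 0)"

end

theory Submission
  imports Defs
begin

text \<open>A triple of bounded-below \<open>\<Lambda>\<^sub>i\<close>, bounded-below \<open>log W\<^sub>i\<close> and bounded-above \<open>Y\<^sub>i\<close> has positive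
  probability, and unboundedness of \<open>\<Lambda>\<close> or \<open>W\<close> lets one push \<open>\<Lambda>\<^sub>i + log W\<^sub>i - \<lambda> Y\<^sub>i\<close> above any
  level \<open>m\<close> on it; by independence \<open>M\<^sub>k \<ge> m\<close> fails with geometrically small probability. Once
  \<open>M\<^sub>k \<ge> m\<close>, every index missing from \<open>D\<^sub>k\<close> satisfies \<open>\<Lambda>\<^sub>i + log W\<^sub>i + \<lambda> Y\<^sub>i \<ge> m\<close>, which for large \<open>m\<close>
  is unlikely uniformly in \<open>i\<close>, so Markov's inequality bounds the fraction of missing indices.\<close>

section \<open>Tail estimates and complements of independent events\<close>

text \<open>As \<open>X\<close> is real-valued, the events \<open>X \<ge> n\<close> decrease to the
  empty set, so continuity from above applies. Monotonicity in the threshold then turns one good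
  integer into a bound for every larger \<open>x\<close>.\<close>

lemma (in prob_space) tail_prob_small:
  fixes X :: "'a \<Rightarrow> real"
  assumes [measurable]: "X \<in> borel_measurable M" and "e > 0"
  obtains x0 where "\<And>x. x \<ge> x0 \<Longrightarrow> prob {\<omega> \<in> space M. X \<omega> \<ge> x} < e"
proof -
  have "(\<lambda>n. prob {\<omega> \<in> space M. X \<omega> \<ge> real n}) \<longlonglongrightarrow> prob (\<Inter>n. {\<omega> \<in> space M. X \<omega> \<ge> real n})"
    by (rule finite_Lim_measure_decseq) (auto simp: decseq_def)
  moreover have "(\<Inter>n. {\<omega> \<in> space M. X \<omega> \<ge> real n}) = {}"
  proof -
    have "\<exists>n. X \<omega> < real n" for \<omega>
      by (rule reals_Archimedean2)
    then show ?thesis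
      by (auto simp: not_le[symmetric])
  qed
  ultimately have "(\<lambda>n. prob {\<omega> \<in> space M. X \<omega> \<ge> real n}) \<longlonglongrightarrow> 0"
    by simp
  from order_tendstoD(2)[OF this \<open>e > 0\<close>] obtain n where n: "prob {\<omega> \<in> space M. X \<omega> \<ge> real n} < e"
    by (auto simp: eventually_sequentially)
  show ?thesis
  proof (rule that[of "real n"])
    fix x assume "x \<ge> real n"
    then have "prob {\<omega> \<in> space M. X \<omega> \<ge> x} \<le> prob {\<omega> \<in> space M. X \<omega> \<ge> real n}"
      by (intro finite_measure_mono) auto
    then show "prob {\<omega> \<in> space M. X \<omega> \<ge> x} < e"
      using n by simp
  qed
qed

text \<open>An upper tail of \<open>- X\<close> has probability below 1, and its complement is an
  event of the form \<open>X > a\<close>. This supplies the positive-probability bounds for the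
  variables on which no unboundedness is assumed.\<close>

lemma (in prob_space) prob_gt_pos:
  fixes X :: "'a \<Rightarrow> real"
  assumes [measurable]: "X \<in> borel_measurable M"
  obtains a where "prob {\<omega> \<in> space M. X \<omega> > a} > 0"
proof -
  obtain x where x: "prob {\<omega> \<in> space M. - X \<omega> \<ge> x} < 1"
    using tail_prob_small[of "\<lambda>\<omega>. - X \<omega>" 1] by auto
  have "{\<omega> \<in> space M. X \<omega> > - x} = space M - {\<omega> \<in> space M. - X \<omega> \<ge> x}"
    by auto
  then have "prob {\<omega> \<in> space M. X \<omega> > - x} > 0"
    using x by (simp add: prob_compl)
  then show ?thesis
    by (rule that)
qed

lemma (in prob_space) prob_no_event:
  assumes "indep_events E I" "finite I" and p: "\<And>i. i \<in> I \<Longrightarrow> prob (E i) = p"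
  shows "prob {\<omega> \<in> space M. \<forall>i\<in>I. \<omega> \<notin> E i} = (1 - p) ^ card I"
proof (cases "I = {}")
  case False
  have ev: "E i \<in> events" if "i \<in> I" for i
    using assms(1) that by (auto simp: indep_events_def)
  \<comment> \<open>A one-element family is closed under intersection, so independence extends to
    the sigma-algebras generated by the single events, and these contain the complements.\<close>
  have "indep_sets (\<lambda>i. sigma_sets (space M) {E i}) I"
    using assms(1) by (intro indep_sets_sigma) (auto simp: indep_events_def_alt Int_stable_def)
  moreover have "\<forall>i\<in>I. space M - E i \<in> sigma_sets (space M) {E i}"
    by (auto intro: sigma_sets.Compl sigma_sets.Basic)
  ultimately have "prob (\<Inter>i\<in>I. space M - E i) = (\<Prod>i\<in>I. prob (space M - E i))"
    using False \<open>finite I\<close> by (intro indep_setsD[of _ I I]) auto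
  also have "\<dots> = (\<Prod>i\<in>I. 1 - p)"
    using ev p by (intro prod.cong) (auto simp: prob_compl)
  also have "(\<Inter>i\<in>I. space M - E i) = {\<omega> \<in> space M. \<forall>i\<in>I. \<omega> \<notin> E i}"
    using False by auto
  finally show ?thesis
    by simp
qed (simp add: prob_space)

section \<open>Product formulas for independent i.i.d. sequences\<close>

lemma iid_copies_measurable:
  assumes "prob_space P" "iid_copies P X N Z" "i \<ge> 1"
  shows "X i \<in> borel_measurable P"
  using assms by (auto simp: iid_copies_def prob_space.indep_vars_def)

lemma iid_copies_prob:
  assumes "prob_space P" "iid_copies P X N Z" "Z \<in> borel_measurable N" "i \<ge> 1" "A \<in> sets borel"
  shows "measure P {\<omega> \<in> space P. X i \<omega> \<in> A} = measure N {\<omega> \<in> space N. Z \<omega> \<in> A}"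
proof -
  have "measure (distr P borel (X i)) A = measure (distr N borel Z) A"
    using assms by (simp add: iid_copies_def)
  then show ?thesis
    using assms iid_copies_measurable[OF assms(1,2,4)]
    by (simp add: measure_distr vimage_def Int_def conj_commute)
qed

lemma iid_copies_prob_Ball:
  assumes "prob_space P" "iid_copies P X N Z" "Z \<in> borel_measurable N" "A \<in> sets borel"
    and J: "J \<subseteq> {1..}" "finite J" "J \<noteq> {}"
  shows "measure P {\<omega> \<in> space P. \<forall>j\<in>J. X j \<omega> \<in> A} = measure N {\<omega> \<in> space N. Z \<omega> \<in> A} ^ card J"
proof -
  interpret P: prob_space P by fact
  have "P.indep_vars (\<lambda>_. borel) X J"
    using assms(2) J(1) by (auto simp: iid_copies_def intro: P.indep_vars_subset)
  then have "P.prob (\<Inter>j\<in>J. X j -` A \<inter> space P) = (\<Prod>j\<in>J. P.prob (X j -` A \<inter> space P))"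
    using J assms(4) by (intro P.indep_varsD_finite) auto
  also have "\<dots> = (\<Prod>j\<in>J. measure N {\<omega> \<in> space N. Z \<omega> \<in> A})"
  proof (rule prod.cong)
    fix j assume "j \<in> J"
    then have "j \<ge> 1" using J by auto
    from iid_copies_prob[OF assms(1-3) this assms(4)]
    show "P.prob (X j -` A \<inter> space P) = measure N {\<omega> \<in> space N. Z \<omega> \<in> A}"
      by (simp add: vimage_def Int_def conj_commute)
  qed simp
  also have "(\<Inter>j\<in>J. X j -` A \<inter> space P) = {\<omega> \<in> space P. \<forall>j\<in>J. X j \<omega> \<in> A}"
    using J by auto
  finally show ?thesis
    by simp
qed

text \<open>A condition on finitely many coordinates of a sequence defines a measurable cylinder in
  the product space, so independence of the sequences as random elements factors the probability
  over \<open>s\<close>.\<close>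

lemma mutually_indep_seqs_prob_Ball:
  assumes "prob_space P" "mutually_indep_seqs P Xs" "Xs \<noteq> []" "J \<subseteq> {1..}" "finite J"
    and A: "\<And>s. s < length Xs \<Longrightarrow> A s \<in> sets borel"
  shows "measure P {\<omega> \<in> space P. \<forall>s<length Xs. \<forall>j\<in>J. (Xs ! s) j \<omega> \<in> A s} =
    (\<Prod>s<length Xs. measure P {\<omega> \<in> space P. \<forall>j\<in>J. (Xs ! s) j \<omega> \<in> A s})"
proof -
  interpret P: prob_space P by fact
  let ?S = "\<lambda>s. {f \<in> space (PiM {1..} (\<lambda>_::nat. borel::real measure)). \<forall>j\<in>J. f j \<in> A s}"
  let ?X = "\<lambda>s \<omega>. \<lambda>i\<in>{1..}. (Xs ! s) i \<omega>"
  have S: "?S s \<in> sets (PiM {1..} (\<lambda>_. borel))" if "s < length Xs" for s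
  proof (rule sets.sets_Collect_finite_All)
    fix j assume "j \<in> J"
    then have "(\<lambda>f. f j) \<in> measurable (PiM {1..} (\<lambda>_::nat. borel::real measure)) borel"
      using \<open>J \<subseteq> {1..}\<close> by (intro measurable_component_singleton) auto
    from measurable_sets[OF this A[OF that]]
    show "{f \<in> space (PiM {1..} (\<lambda>_. borel)). f j \<in> A s} \<in> sets (PiM {1..} (\<lambda>_. borel))"
      by (simp add: vimage_def Int_def conj_commute)
  qed fact
  \<comment> \<open>Restricting to \<open>{1..}\<close> makes the sequence an element of the product
    space, and since \<open>J\<close> lies in \<open>{1..}\<close> its coordinates in
    \<open>J\<close> are the original variables.\<close>
  have eq: "?X s -` ?S s \<inter> space P = {\<omega> \<in> space P. \<forall>j\<in>J. (Xs ! s) j \<omega> \<in> A s}" for s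
    using \<open>J \<subseteq> {1..}\<close> by (auto simp: space_PiM)
  have "P.prob (\<Inter>s\<in>{..<length Xs}. ?X s -` ?S s \<inter> space P) =
      (\<Prod>s<length Xs. P.prob (?X s -` ?S s \<inter> space P))"
    using assms(2,3) S unfolding mutually_indep_seqs_def
    by (intro P.indep_varsD_finite) auto
  also have "(\<Inter>s\<in>{..<length Xs}. ?X s -` ?S s \<inter> space P) =
      {\<omega> \<in> space P. \<forall>s<length Xs. \<forall>j\<in>J. (Xs ! s) j \<omega> \<in> A s}"
    unfolding eq using \<open>Xs \<noteq> []\<close> by auto
  finally show ?thesis
    unfolding eq .
qed

text \<open>The probability of a joint occurrence over \<open>J\<close> is factored twice, first
  across the three sequences and then along each of them. The resulting value
  \<open>p ^ card J\<close> yields the common probability when \<open>J\<close> is a singleton, and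
  then independence.\<close>

lemma iid_triples_indep_events:
  assumes "prob_space P" "mutually_indep_seqs P [X, Y, Z]"
    and X: "iid_copies P X N U" "U \<in> borel_measurable N"
    and Y: "iid_copies P Y N V" "V \<in> borel_measurable N"
    and Z: "iid_copies P Z N T" "T \<in> borel_measurable N"
    and A: "A \<in> sets borel" "B \<in> sets borel" "C \<in> sets borel"
  defines "E \<equiv> \<lambda>i. {\<omega> \<in> space P. X i \<omega> \<in> A \<and> Y i \<omega> \<in> B \<and> Z i \<omega> \<in> C}"
    and "p \<equiv> measure N {\<omega> \<in> space N. U \<omega> \<in> A} * measure N {\<omega> \<in> space N. V \<omega> \<in> B} *
      measure N {\<omega> \<in> space N. T \<omega> \<in> C}"
  shows "prob_space.indep_events P E {1..}" and "\<And>i. i \<ge> 1 \<Longrightarrow> measure P (E i) = p"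
proof -
  interpret P: prob_space P by fact
  have Inter: "P.prob (\<Inter>j\<in>J. E j) = p ^ card J" if J: "J \<subseteq> {1..}" "finite J" "J \<noteq> {}" for J
  proof -
    have "(\<Inter>j\<in>J. E j) = {\<omega> \<in> space P. \<forall>s<length [X, Y, Z]. \<forall>j\<in>J. ([X, Y, Z] ! s) j \<omega> \<in> [A, B, C] ! s}"
      using \<open>J \<noteq> {}\<close> by (auto simp: E_def less_Suc_eq numeral_3_eq_3)
    also have "P.prob \<dots> = (\<Prod>s<length [X, Y, Z]. P.prob {\<omega> \<in> space P. \<forall>j\<in>J. ([X, Y, Z] ! s) j \<omega> \<in> [A, B, C] ! s})"
      using A by (intro mutually_indep_seqs_prob_Ball assms J) (auto simp: less_Suc_eq)
    also have "\<dots> = p ^ card J"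
      using iid_copies_prob_Ball[OF assms(1) X A(1) J] iid_copies_prob_Ball[OF assms(1) Y A(2) J]
        iid_copies_prob_Ball[OF assms(1) Z A(3) J]
      by (simp add: p_def power_mult_distrib)
    finally show ?thesis .
  qed
  show p: "P.prob (E i) = p" if "i \<ge> 1" for i
    using Inter[of "{i}"] that by simp
  have ev: "E i \<in> P.events" if "i \<ge> 1" for i
  proof -
    note [measurable] = iid_copies_measurable[OF assms(1) X(1) that]
      iid_copies_measurable[OF assms(1) Y(1) that] iid_copies_measurable[OF assms(1) Z(1) that] A
    show ?thesis unfolding E_def by measurable
  qed
  show "P.indep_events E {1..}"
    unfolding P.indep_events_def
  proof (intro conjI allI impI ballI)
    show "E ` {1..} \<subseteq> P.events"
      using ev by auto
    fix J :: "nat set" assume J: "J \<subseteq> {1..}" "J \<noteq> {}" "finite J"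
    then have "(\<Prod>j\<in>J. P.prob (E j)) = (\<Prod>j\<in>J. p)"
      by (intro prod.cong) (auto simp: p)
    then show "P.prob (\<Inter>j\<in>J. E j) = (\<Prod>j\<in>J. P.prob (E j))"
      using Inter J by simp
  qed
qed

section \<open>Markov's inequality for a count of events\<close>

text \<open>Markov's inequality for the number of events that occur, whose mean is the sum of their
  probabilities.\<close>

lemma (in prob_space) prob_count_ge_le:
  fixes c d :: real
  assumes ev: "\<And>i. i \<in> I \<Longrightarrow> E i \<in> events" and "finite I"
    and d: "\<And>i. i \<in> I \<Longrightarrow> prob (E i) \<le> d" and "c > 0"
  shows "prob {\<omega> \<in> space M. (\<Sum>i\<in>I. indicat_real (E i) \<omega>) \<ge> c} \<le> card I * d / c"
proof -
  have int: "integrable M (\<lambda>\<omega>. \<Sum>i\<in>I. indicat_real (E i) \<omega>)"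
    using ev by (intro Bochner_Integration.integrable_sum) (simp add: emeasure_eq_measure)
  have "prob {\<omega> \<in> space M. (\<Sum>i\<in>I. indicat_real (E i) \<omega>) \<ge> c} \<le>
      expectation (\<lambda>\<omega>. \<Sum>i\<in>I. indicat_real (E i) \<omega>) / c"
    using int \<open>c > 0\<close> by (intro integral_Markov_inequality_measure[where A="{}"]) (auto intro: sum_nonneg)
  also have "expectation (\<lambda>\<omega>. \<Sum>i\<in>I. indicat_real (E i) \<omega>) = (\<Sum>i\<in>I. prob (E i))"
    using ev by (subst Bochner_Integration.integral_sum) (auto simp: emeasure_eq_measure)
  also have "\<dots> \<le> card I * d"
    using sum_mono[of I "\<lambda>i. prob (E i)" "\<lambda>_. d"] d by simp
  finally show ?thesis
    using \<open>c > 0\<close> by (simp add: divide_right_mono)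
qed

theorem theorem2p5:
  fixes N :: "'b measure" and \<Lambda> W Y :: "'b \<Rightarrow> real"
    and P :: "'a measure" and \<Lambda>s Ws Ys :: "nat \<Rightarrow> 'a \<Rightarrow> real"
    and lam :: real
  assumes "lam > 0"
    and "prob_space N"
    and "\<Lambda> \<in> borel_measurable N" and "W \<in> borel_measurable N" and "Y \<in> borel_measurable N"
    and "AE \<omega> in N. W \<omega> > 0" and "AE \<omega> in N. Y \<omega> > 0"
    and "prob_space P"
    and "iid_copies P \<Lambda>s N \<Lambda>" and "iid_copies P Ws N W" and "iid_copies P Ys N Y"
    and "mutually_indep_seqs P [\<Lambda>s, Ws, Ys]"
    and "(\<forall>x. measure N {\<omega> \<in> space N. \<Lambda> \<omega> > x} > 0) \<or>
         (\<forall>x. measure N {\<omega> \<in> space N. W \<omega> > x} > 0)"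
  shows "tendsto_in_prob P (\<lambda>k \<omega>. D_hat lam \<Lambda>s Ws Ys k \<omega> / real k) 1"
proof -
  interpret N: prob_space N by fact
  interpret P: prob_space P by fact
  note [measurable] = assms(3-5)
  note L_meas = iid_copies_measurable[OF assms(8,9)]
    and W_meas = iid_copies_measurable[OF assms(8,10)]
    and Y_meas = iid_copies_measurable[OF assms(8,11)]

  \<comment> \<open>The maximum, the compared quantities and their measurability\<close>
  define M where "M = M_max lam \<Lambda>s Ws Ys"
  define F where "F = (\<lambda>i \<omega>. \<Lambda>s i \<omega> + ln (Ws i \<omega>) + lam * Ys i \<omega>)"
  define G where "G = (\<lambda>i \<omega>. \<Lambda>s i \<omega> + ln (Ws i \<omega>) - lam * Ys i \<omega>)"
  have F_meas: "F i \<in> borel_measurable P" and G_meas: "G i \<in> borel_measurable P" if "i \<ge> 1" for i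
  proof -
    note [measurable] = L_meas[OF that] W_meas[OF that] Y_meas[OF that]
    show "F i \<in> borel_measurable P" "G i \<in> borel_measurable P"
      unfolding F_def G_def by measurable
  qed
  have M_eq: "M k \<omega> = Max ((\<lambda>i. G i \<omega>) ` {1..k})" for k \<omega>
    by (simp add: M_def M_max_def G_def)
  \<comment> \<open>The case \<open>k = 0\<close> is covered too: there the maximum is over the
    empty set and is the same unspecified constant for every \<open>\<omega>\<close>.\<close>
  have M_meas [measurable]: "M k \<in> borel_measurable P" for k
  proof -
    have "(\<lambda>\<omega>. Max ((\<lambda>i. G i \<omega>) ` {1..k})) \<in> borel_measurable P"
      using G_meas by (intro borel_measurable_Max) auto
    then show ?thesis
      using M_eq by (simp cong: measurable_cong)
  qed
  have D_eq: "D_hat lam \<Lambda>s Ws Ys k \<omega> = 1 + (\<Sum>i=1..k. if F i \<omega> < M k \<omega> then 1 else 0)" for k \<omega>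
    by (simp add: D_hat_def F_def M_def)
  have D_meas [measurable]: "D_hat lam \<Lambda>s Ws Ys k \<in> borel_measurable P" for k
  proof -
    have "(\<lambda>\<omega>. if F i \<omega> < M k \<omega> then 1 else 0 :: real) \<in> borel_measurable P" if "i \<ge> 1" for i
    proof -
      note [measurable] = F_meas[OF that]
      show ?thesis by measurable
    qed
    then show ?thesis
      unfolding D_eq[abs_def] by (intro borel_measurable_add borel_measurable_sum) auto
  qed

  \<comment> \<open>Divergence of the maximum in probability\<close>
  have M_lim: "(\<lambda>k. P.prob {\<omega> \<in> space P. M k \<omega> < m}) \<longlonglongrightarrow> 0" for m
  proof -
    \<comment> \<open>A lower bound for \<open>- Y\<close> serves as an upper bound
      \<open>c = - c'\<close> for \<open>Y\<close>.\<close>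
    obtain c' where "N.prob {\<omega> \<in> space N. - Y \<omega> > c'} > 0"
      by (rule N.prob_gt_pos[of "\<lambda>\<omega>. - Y \<omega>"]) simp
    moreover define c where "c = - c'"
    ultimately have c: "N.prob {\<omega> \<in> space N. Y \<omega> < c} > 0"
      by (simp add: less_minus_iff)
    \<comment> \<open>The variable without assumed unboundedness gets any threshold exceeded with
      positive probability; the threshold of the unbounded one is then set so that
      \<open>a + b - lam * c = m\<close>.\<close>
    obtain a b where ab: "N.prob {\<omega> \<in> space N. \<Lambda> \<omega> > a} > 0"
      "N.prob {\<omega> \<in> space N. ln (W \<omega>) > b} > 0" "a + b - lam * c \<ge> m"
      using assms(13)
    proof
      assume *: "\<forall>x. N.prob {\<omega> \<in> space N. \<Lambda> \<omega> > x} > 0"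
      obtain b where "N.prob {\<omega> \<in> space N. ln (W \<omega>) > b} > 0"
        by (rule N.prob_gt_pos[of "\<lambda>\<omega>. ln (W \<omega>)"]) simp
      then show ?thesis
        using * by (intro that[of "m - b + lam * c" b]) simp_all
    next
      assume *: "\<forall>x. N.prob {\<omega> \<in> space N. W \<omega> > x} > 0"
      obtain a where a: "N.prob {\<omega> \<in> space N. \<Lambda> \<omega> > a} > 0"
        by (rule N.prob_gt_pos[of \<Lambda>]) simp
      define b where "b = m - a + lam * c"
      \<comment> \<open>Because \<open>exp b > 0\<close>, the left-hand event only involves positive
        values of \<open>W\<close>, where \<open>ln\<close> is the true logarithm and is strictly
        increasing.\<close>
      have "{\<omega> \<in> space N. W \<omega> > exp b} \<subseteq> {\<omega> \<in> space N. ln (W \<omega>) > b}"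
        using ln_less_cancel_iff[of "exp b"] by (fastforce intro: less_trans[OF exp_gt_zero])
      then have "N.prob {\<omega> \<in> space N. W \<omega> > exp b} \<le> N.prob {\<omega> \<in> space N. ln (W \<omega>) > b}"
        by (intro N.finite_measure_mono) auto
      then show ?thesis
        using a * by (intro that[of a b]) (auto simp: b_def intro: less_le_trans)
    qed
    define p where "p = N.prob {\<omega> \<in> space N. \<Lambda> \<omega> \<in> {a<..}} *
      N.prob {\<omega> \<in> space N. W \<omega> \<in> {w. ln w > b}} * N.prob {\<omega> \<in> space N. Y \<omega> \<in> {..<c}}"
    define E where "E = (\<lambda>i. {\<omega> \<in> space P. \<Lambda>s i \<omega> \<in> {a<..} \<and> Ws i \<omega> \<in> {w. ln w > b} \<and> Ys i \<omega> \<in> {..<c}})"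
    have "{w :: real. ln w > b} \<in> sets borel"
      by measurable
    note triples = iid_triples_indep_events[OF assms(8,12,9,3,10,4,11,5) _ this, of "{a<..}" "{..<c}"]
    have E_indep: "P.indep_events E {1..}"
      unfolding E_def by (rule triples(1)) simp_all
    have E_prob: "P.prob (E i) = p" if "i \<ge> 1" for i
      unfolding E_def p_def by (rule triples(2)) (use that in simp_all)
    have "p > 0"
      using ab c by (simp add: p_def)
    have "p \<le> 1"
      using E_prob[of 1] P.prob_le_1[of "E 1"] by simp
    have bound: "P.prob {\<omega> \<in> space P. M k \<omega> < m} \<le> (1 - p) ^ k" for k
    proof -
      \<comment> \<open>On \<open>E i\<close> the three bounds give
        \<open>G i \<omega> > a + b - lam * c \<ge> m\<close>; positivity of \<open>lam\<close>
        turns the upper bound on \<open>Ys i\<close> into a lower bound on the subtracted term's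
        negative.\<close>
      have G_gt: "G i \<omega> > m" if "\<omega> \<in> E i" for i \<omega>
      proof -
        have "lam * Ys i \<omega> < lam * c"
          using that \<open>lam > 0\<close> by (simp add: E_def)
        then show ?thesis
          using that ab(3) by (simp add: E_def G_def)
      qed
      have "\<omega> \<notin> E i" if "M k \<omega> < m" "i \<in> {1..k}" for i \<omega>
      proof
        assume "\<omega> \<in> E i"
        then have "m < G i \<omega>"
          by (rule G_gt)
        also have "G i \<omega> \<le> M k \<omega>"
          using that(2) by (simp add: M_eq)
        finally show False
          using that(1) by simp
      qed
      then have sub: "{\<omega> \<in> space P. M k \<omega> < m} \<subseteq> {\<omega> \<in> space P. \<forall>i\<in>{1..k}. \<omega> \<notin> E i}"
        by blast
      \<comment> \<open>Monotonicity of the measure asks for measurability of the larger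
        event.\<close>
      have "E i \<in> P.events" if "i \<in> {1..k}" for i
        using E_indep that by (auto simp: P.indep_events_def)
      then have "space P - (\<Union>i\<in>{1..k}. E i) \<in> P.events"
        by (intro sets.compl_sets sets.finite_UN) auto
      also have "space P - (\<Union>i\<in>{1..k}. E i) = {\<omega> \<in> space P. \<forall>i\<in>{1..k}. \<omega> \<notin> E i}"
        by blast
      finally have "P.prob {\<omega> \<in> space P. M k \<omega> < m} \<le> P.prob {\<omega> \<in> space P. \<forall>i\<in>{1..k}. \<omega> \<notin> E i}"
        by (rule P.finite_measure_mono[OF sub])
      also have "\<dots> = (1 - p) ^ card {1..k}"
      proof (rule P.prob_no_event)
        show "P.indep_events E {1..k}"
          using E_indep P.indep_sets_mono_index[of "{1..k}" "{1..}"]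
          by (simp add: P.indep_events_def_alt subset_eq)
      qed (use E_prob in auto)
      finally show ?thesis
        by simp
    qed
    show ?thesis
    proof (rule Lim_null_comparison)
      show "(\<lambda>k. (1 - p) ^ k) \<longlonglongrightarrow> 0"
        using \<open>p > 0\<close> \<open>p \<le> 1\<close> by (intro LIMSEQ_power_zero) auto
    qed (simp add: bound)
  qed

  \<comment> \<open>A tail bound for the compared quantities, uniform in the index\<close>
  have F_tail: "\<exists>m. \<forall>i\<ge>1. P.prob {\<omega> \<in> space P. F i \<omega> \<ge> m} \<le> d" if "d > 0" for d
  proof -
    obtain x where x: "\<And>t. t \<ge> x \<Longrightarrow> N.prob {\<omega> \<in> space N. \<Lambda> \<omega> \<ge> t} < d / 3"
      using N.tail_prob_small[of \<Lambda> "d / 3"] \<open>d > 0\<close> by auto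
    obtain y where y: "\<And>t. t \<ge> y \<Longrightarrow> N.prob {\<omega> \<in> space N. ln (W \<omega>) \<ge> t} < d / 3"
      using N.tail_prob_small[of "\<lambda>\<omega>. ln (W \<omega>)" "d / 3"] \<open>d > 0\<close> by auto
    obtain z where z: "\<And>t. t \<ge> z \<Longrightarrow> N.prob {\<omega> \<in> space N. lam * Y \<omega> \<ge> t} < d / 3"
      using N.tail_prob_small[of "\<lambda>\<omega>. lam * Y \<omega>" "d / 3"] \<open>d > 0\<close> by auto
    \<comment> \<open>A sum of at least \<open>x + y + z\<close> forces some summand to reach its
      own threshold, so a union bound applies. The thresholds depend only on the common laws on
      \<open>N\<close>, hence not on \<open>i\<close>.\<close>
    have "P.prob {\<omega> \<in> space P. F i \<omega> \<ge> x + y + z} \<le> d" if "i \<ge> 1" for i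
    proof -
      note [measurable] = L_meas[OF that] W_meas[OF that] Y_meas[OF that]
      let ?A = "{\<omega> \<in> space P. \<Lambda>s i \<omega> \<in> {x..}}"
        and ?B = "{\<omega> \<in> space P. Ws i \<omega> \<in> {w. ln w \<ge> y}}"
        and ?C = "{\<omega> \<in> space P. Ys i \<omega> \<in> {v. lam * v \<ge> z}}"
      have "P.prob {\<omega> \<in> space P. F i \<omega> \<ge> x + y + z} \<le> P.prob (?A \<union> ?B \<union> ?C)"
        by (intro P.finite_measure_mono) (auto simp: F_def)
      also have "\<dots> \<le> P.prob ?A + P.prob ?B + P.prob ?C"
        by (intro order_trans[OF measure_Un_le] add_mono) simp_all
      also have "P.prob ?A < d / 3"
        using x[of x] iid_copies_prob[OF assms(8,9,3) that, of "{x..}"] by simp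
      also have "P.prob ?B < d / 3"
        using y[of y] iid_copies_prob[OF assms(8,10,4) that, of "{w. ln w \<ge> y}"] by simp
      also have "P.prob ?C < d / 3"
        using z[of z] iid_copies_prob[OF assms(8,11,5) that, of "{v. lam * v \<ge> z}"] by simp
      finally show ?thesis by simp
    qed
    then show ?thesis by blast
  qed

  \<comment> \<open>Convergence in probability of the normalised count\<close>
  have "(\<lambda>k. P.prob {\<omega> \<in> space P. \<bar>D_hat lam \<Lambda>s Ws Ys k \<omega> / real k - 1\<bar> > \<epsilon>}) \<longlonglongrightarrow> 0"
    if "\<epsilon> > 0" for \<epsilon> :: real
  proof (rule LIMSEQ_I, unfold diff_0_right)
    fix r :: real assume "r > 0"
    \<comment> \<open>The level \<open>r * \<epsilon> / 4\<close> is tuned to the Markov threshold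
      \<open>\<epsilon> * real k / 2\<close> used below: the quotient comes out as
      \<open>r / 2\<close> for every positive \<open>k\<close>.\<close>
    obtain m where m: "\<And>i. i \<ge> 1 \<Longrightarrow> P.prob {\<omega> \<in> space P. F i \<omega> \<ge> m} \<le> r * \<epsilon> / 4"
      using F_tail[of "r * \<epsilon> / 4"] \<open>r > 0\<close> \<open>\<epsilon> > 0\<close> by auto
    define B where "B = (\<lambda>i. {\<omega> \<in> space P. F i \<omega> \<ge> m})"
    have B_ev: "B i \<in> P.events" if "i \<ge> 1" for i
    proof -
      note [measurable] = F_meas[OF that]
      show ?thesis unfolding B_def by measurable
    qed
    have "eventually (\<lambda>k. P.prob {\<omega> \<in> space P. M k \<omega> < m} < r / 2) sequentially"
      using M_lim \<open>r > 0\<close> by (intro order_tendstoD(2)) auto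
    then obtain k0 where k0: "\<And>k. k \<ge> k0 \<Longrightarrow> P.prob {\<omega> \<in> space P. M k \<omega> < m} < r / 2"
      by (auto simp: eventually_sequentially)
    \<comment> \<open>The leading 1 in \<open>D_hat\<close> lets it exceed \<open>k\<close> by at
      most 1. Once \<open>\<epsilon> * real k > 2\<close>, such an upward deviation cannot reach
      \<open>\<epsilon> * real k\<close>.\<close>
    obtain k1 where k1: "real k1 > 2 / \<epsilon>"
      using reals_Archimedean2 by blast
    show "\<exists>no. \<forall>k\<ge>no. norm (P.prob {\<omega> \<in> space P. \<bar>D_hat lam \<Lambda>s Ws Ys k \<omega> / real k - 1\<bar> > \<epsilon>}) < r"
    proof (intro exI[of _ "max k0 k1"] allI impI)
      fix k assume k: "k \<ge> max k0 k1"
      then have k_gt: "real k > 2 / \<epsilon>"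
        using k1 by (meson le_less_trans max.boundedE not_le of_nat_le_iff)
      have kpos: "real k > 0"
        by (rule less_trans[OF _ k_gt]) (use \<open>\<epsilon> > 0\<close> in simp)
      have keps: "\<epsilon> * real k > 2"
        using k_gt \<open>\<epsilon> > 0\<close> by (simp add: field_simps)
      define R where "R = (\<lambda>\<omega>. \<Sum>i\<in>{1..k}. indicat_real (B i) \<omega>)"
      have R_meas [measurable]: "R \<in> borel_measurable P"
        unfolding R_def using B_ev by (intro borel_measurable_sum borel_measurable_indicator) auto
      have R_large: "R \<omega> \<ge> \<epsilon> * real k / 2"
        if \<omega>: "\<omega> \<in> space P" "M k \<omega> \<ge> m" "\<bar>D_hat lam \<Lambda>s Ws Ys k \<omega> / real k - 1\<bar> > \<epsilon>" for \<omega>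
      proof -
        have "real k - R \<omega> = (\<Sum>i=1..k. 1 - indicat_real (B i) \<omega>)"
          by (simp add: R_def sum_subtractf)
        \<comment> \<open>Termwise: outside \<open>B i\<close> one has
          \<open>F i \<omega> < m \<le> M k \<omega>\<close>, so the index is counted; inside
          \<open>B i\<close> the left term is 0.\<close>
        also have "\<dots> \<le> (\<Sum>i=1..k. if F i \<omega> < M k \<omega> then 1 else 0)"
          using \<omega> by (intro sum_mono) (auto simp: B_def indicator_def)
        finally have lower: "D_hat lam \<Lambda>s Ws Ys k \<omega> \<ge> 1 + real k - R \<omega>"
          by (simp add: D_eq)
        have "(\<Sum>i=1..k. if F i \<omega> < M k \<omega> then 1 else 0 :: real) \<le> (\<Sum>i=1..k. 1)"
          by (intro sum_mono) auto
        then have upper: "D_hat lam \<Lambda>s Ws Ys k \<omega> \<le> 1 + real k"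
          by (simp add: D_eq)
        have "D_hat lam \<Lambda>s Ws Ys k \<omega> / real k - 1 = (D_hat lam \<Lambda>s Ws Ys k \<omega> - real k) / real k"
          using kpos by (simp add: field_simps)
        then have "\<epsilon> * real k < \<bar>D_hat lam \<Lambda>s Ws Ys k \<omega> - real k\<bar>"
          using \<omega>(3) kpos by (simp add: pos_less_divide_eq)
        \<comment> \<open>Only a downward deviation remains, and \<open>lower\<close> converts it
          into \<open>R \<omega> > \<epsilon> * real k + 1\<close>, more than is claimed.\<close>
        then show ?thesis
          using lower upper keps by linarith
      qed
      \<comment> \<open>A deviation requires either a maximum below \<open>m\<close>, or many
        indices with \<open>F i\<close> at least \<open>m\<close>; each of these gets half of
        \<open>r\<close>.\<close>
      have "P.prob {\<omega> \<in> space P. \<bar>D_hat lam \<Lambda>s Ws Ys k \<omega> / real k - 1\<bar> > \<epsilon>}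
          \<le> P.prob ({\<omega> \<in> space P. M k \<omega> < m} \<union> {\<omega> \<in> space P. R \<omega> \<ge> \<epsilon> * real k / 2})"
      proof (rule P.finite_measure_mono)
        show "{\<omega> \<in> space P. \<bar>D_hat lam \<Lambda>s Ws Ys k \<omega> / real k - 1\<bar> > \<epsilon>}
            \<subseteq> {\<omega> \<in> space P. M k \<omega> < m} \<union> {\<omega> \<in> space P. R \<omega> \<ge> \<epsilon> * real k / 2}"
          using R_large not_less by blast
      qed measurable
      also have "\<dots> \<le> P.prob {\<omega> \<in> space P. M k \<omega> < m} + P.prob {\<omega> \<in> space P. R \<omega> \<ge> \<epsilon> * real k / 2}"
        by (rule measure_Un_le) measurable
      also have "\<dots> < r / 2 + r / 2"
      proof (rule add_less_le_mono)
        show "P.prob {\<omega> \<in> space P. M k \<omega> < m} < r / 2"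
          using k0 k by simp
        have "P.prob {\<omega> \<in> space P. R \<omega> \<ge> \<epsilon> * real k / 2} \<le>
            real (card {1..k}) * (r * \<epsilon> / 4) / (\<epsilon> * real k / 2)"
          unfolding R_def
        proof (rule P.prob_count_ge_le)
          show "P.prob (B i) \<le> r * \<epsilon> / 4" if "i \<in> {1..k}" for i
            using m that by (simp add: B_def)
        qed (use B_ev \<open>\<epsilon> > 0\<close> kpos in auto)
        also have "\<dots> = r / 2"
          using \<open>\<epsilon> > 0\<close> kpos by (simp add: field_simps)
        finally show "P.prob {\<omega> \<in> space P. R \<omega> \<ge> \<epsilon> * real k / 2} \<le> r / 2" .
      qed
      finally show "norm (P.prob {\<omega> \<in> space P. \<bar>D_hat lam \<Lambda>s Ws Ys k \<omega> / real k - 1\<bar> > \<epsilon>}) < r"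
        by simp
    qed
  qed
  moreover have "(\<lambda>\<omega>. D_hat lam \<Lambda>s Ws Ys k \<omega> / real k) \<in> borel_measurable P" for k
    by measurable
  ultimately show ?thesis
    unfolding tendsto_in_prob_def by blast
qed

end
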